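(* Let $N\ge 1$, $\theta>0$, let $w(\cdot;N)$ be a positive weight and let $\mathbb P_N$ be the associated probability distribution on $N$-tuples $(\ell_1,\dots,\ell_N)$ (see context). Assume that $$\frac{w(x;N)}{w(x-1;N)}=\frac{\phi^+_N(x)}{\phi^-_N(x)}$$ (for all real $x$ at which the functions $\phi^\pm_N$ are defined), and define $$R_N(\xi)=\phi^-_N(\xi)\cdot \mathbb E_{\mathbb P_N}\left[\prod_{i=1}^N\left(1-\frac{\theta}{\xi-\ell_i}\right)\right]+\phi^+_N(\xi)\cdot\mathbb E_{\mathbb P_N}\left[\prod_{i=1}^N\left(1+\frac{\theta}{\xi-\ell_i-1}\right)\right].$$ If $\phi^\pm_N(\xi)$ are holomorphic in a domain $\mathcal M_N\subset\mathbb C$, then so is $R_N(\xi)$ (i.e. all singularities of $R_N$ in $\mathcal M_N$ are removable). Moreover, if $\phi^\pm_N(\xi)$ are polynomials of degree at most $d$, then so is $R_N(\xi)$.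
   Context: Fix $\theta>0$ and $N\ge1$. Let $w(x;N)$, $x\in\mathbb R$, be a positive real-valued function decaying at least as fast as $|x|^{-(2N-2)\theta-1-\mathrm{const}}$, with some $\mathrm{const}>0$, as $|x|\to\infty$. The distribution $\mathbb P_N$ is the probability distribution $$\mathbb P_N(\ell_1,\dots,\ell_N)=\frac1{Z_N}\prod_{1\le i<j\le N}\frac{\Gamma(\ell_j-\ell_i+1)\Gamma(\ell_j-\ell_i+\theta)}{\Gamma(\ell_j-\ell_i)\Gamma(\ell_j-\ell_i+1-\theta)}\prod_{i=1}^N w(\ell_i;N)$$ on ordered $N$-tuples $\ell_1<\ell_2<\dots<\ell_N$ such that $\ell_i=\lambda_i+\theta i$, where $\lambda_1\le\lambda_2\le\dots\le\lambda_N$ are integers; $Z_N$ is the normalizing constant. $\mathbb E_{\mathbb P_N}$ is the expectation with respect to $\mathbb P_N$. *)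

theory Defs
  imports
    "HOL-Complex_Analysis.Complex_Analysis"
    "HOL-Library.Landau_Symbols"
begin

text \<open>
  An $N$-tuple is a function on \<open>{1..N}\<close>, taken to be \<^const>\<open>undefined\<close> outside, so that
  distinct functions are distinct tuples.
\<close>

definition configs :: "nat \<Rightarrow> real \<Rightarrow> (nat \<Rightarrow> real) set" where
  "configs N \<theta> =
     {l \<in> extensional {1..N}. strict_mono_on {1..N} l \<and>
        (\<exists>lam :: nat \<Rightarrow> int. mono_on {1..N} lam \<and>
           (\<forall>i\<in>{1..N}. l i = of_int (lam i) + \<theta> * real i))}"

definition config_weight :: "nat \<Rightarrow> real \<Rightarrow> (real \<Rightarrow> real) \<Rightarrow> (nat \<Rightarrow> real) \<Rightarrow> real" where
  "config_weight N \<theta> w l =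
     (\<Prod>i\<in>{1..N}. \<Prod>j\<in>{i<..N}.
        Gamma (l j - l i + 1) * Gamma (l j - l i + \<theta>) /
        (Gamma (l j - l i) * Gamma (l j - l i + 1 - \<theta>))) *
     (\<Prod>i\<in>{1..N}. w (l i))"

definition partition_fun :: "nat \<Rightarrow> real \<Rightarrow> (real \<Rightarrow> real) \<Rightarrow> real" where
  "partition_fun N \<theta> w = (\<Sum>\<^sub>\<infinity>l\<in>configs N \<theta>. config_weight N \<theta> w l)"

definition ensemble :: "nat \<Rightarrow> real \<Rightarrow> (real \<Rightarrow> real) \<Rightarrow> (nat \<Rightarrow> real) measure" where
  "ensemble N \<theta> w =
     point_measure (configs N \<theta>) (\<lambda>l. ennreal (config_weight N \<theta> w l / partition_fun N \<theta> w))"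

text \<open>
  The value of the next function at a point of \<open>nekrasov_sing N \<theta>\<close> is meaningless, since
  division by zero occurs there.
\<close>

definition nekrasov_R ::
  "nat \<Rightarrow> real \<Rightarrow> (real \<Rightarrow> real) \<Rightarrow> (complex \<Rightarrow> complex) \<Rightarrow> (complex \<Rightarrow> complex) \<Rightarrow> complex \<Rightarrow> complex"
where
  "nekrasov_R N \<theta> w \<phi>p \<phi>m \<xi> =
     \<phi>m \<xi> * (\<integral>l. (\<Prod>i\<in>{1..N}. 1 - of_real \<theta> / (\<xi> - of_real (l i))) \<partial>ensemble N \<theta> w) +
     \<phi>p \<xi> * (\<integral>l. (\<Prod>i\<in>{1..N}. 1 + of_real \<theta> / (\<xi> - of_real (l i) - 1)) \<partial>ensemble N \<theta> w)"

definition nekrasov_sing :: "nat \<Rightarrow> real \<Rightarrow> complex set" where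
  "nekrasov_sing N \<theta> =
     (\<Union>l\<in>configs N \<theta>. \<Union>i\<in>{1..N}. {of_real (l i), of_real (l i) + 1})"

end

theory Submission
  imports Defs
begin

text \<open>
  The function \<open>R\<close> is a sum over configurations of terms with simple poles at the points of a
  discrete set of real numbers; the theorem says that these poles cancel.

  For a point \<open>x\<close> and a particle \<open>i\<close>, the factor \<open>1 - \<theta> / (\<xi> - l i)\<close> of the first product has a pole
  at \<open>x\<close> for the configurations with \<open>l i = x\<close>, and the factor \<open>1 + \<theta> / (\<xi> - l i - 1)\<close> of the second
  for those with \<open>l i = x - 1\<close>. Moving the particle \<open>i\<close> one step down matches the former with the
  latter. The step changes the interaction of the particle with every other one by a quotient of
  Gamma functions that is rational and equals the quotient of the corresponding factors of the two
  products (\<open>pair_factor_step\<close>), and it replaces \<open>w x\<close> by \<open>w (x - 1)\<close>, which the prefactors make up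
  for, as \<open>\<phi>m x * w x = \<phi>p x * w (x - 1)\<close>. Since the residues of the moving factors are \<open>- \<theta>\<close> and
  \<open>\<theta>\<close>, matched terms cancel (\<open>residue_term_shift\<close>). A configuration for which the step leads outside the state space has a
  neighbour at distance exactly \<open>\<theta>\<close> on the side of the step, and then another factor of its term is
  zero (\<open>configs_lower_blocked\<close>, \<open>configs_raise_blocked\<close>). So the total residue at \<open>x\<close> is zero
  (\<open>residues_cancel\<close>).

  For this computation to give the residue of \<open>R\<close>, the limit at \<open>x\<close> has to be interchanged with the
  sum over all configurations. The weights are summable, and near \<open>x\<close> the products multiplied by
  \<open>\<xi> - x\<close> are holomorphic and bounded uniformly in the configuration, because the entries of a
  configuration are distinct members of a discrete set (\<open>mean_simple_pole\<close>). The
  singularities of \<open>R\<close> are therefore removable (\<open>holomorphic_extension_across_discrete\<close>).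

  If \<open>\<phi>p\<close> and \<open>\<phi>m\<close> are polynomials of degree at most \<open>d\<close>, the extension \<open>F\<close> is entire. The poles of
  the summands lie in finitely many translates of the integers, so infinitely many circles around
  the origin, with radii increasing by one, stay at a fixed distance from all of them
  (\<open>circles_avoiding_int_translates\<close>). On these circles both expectations are bounded and \<open>F\<close> grows
  no faster than the \<open>d\<close>-th power of the radius, so \<open>F\<close> is a polynomial of degree at most \<open>d\<close>
  (\<open>polynomial_of_growth_on_circles\<close>).
\<close>

section \<open>Holomorphic functions with isolated singularities\<close>

lemma holomorphic_extension_across_discrete:
  fixes f :: "complex \<Rightarrow> complex"
  assumes "open M" and discrete: "\<And>z. z \<in> M \<Longrightarrow> \<not> z islimpt S"
    and hol: "f holomorphic_on M - S"
    and lim: "\<And>z. z \<in> M \<inter> S \<Longrightarrow> ((\<lambda>y. (y - z) * f y) \<longlongrightarrow> 0) (at z)"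
  shows "\<exists>F. F holomorphic_on M \<and> (\<forall>z\<in>M - S. F z = f z)"
proof -
  have "\<exists>r g. r > 0 \<and> ball z r \<subseteq> M \<and> ball z r \<inter> S \<subseteq> {z} \<and> g holomorphic_on ball z r \<and>
          (\<forall>y\<in>ball z r - S. g y = f y)" if z: "z \<in> M" for z
  proof -
    obtain r1 where r1: "r1 > 0" "ball z r1 \<subseteq> M"
      using \<open>open M\<close> z open_contains_ball by blast
    obtain r2 where r2: "r2 > 0" "\<And>y. y \<in> S \<Longrightarrow> y \<noteq> z \<Longrightarrow> \<not> dist y z < r2"
      using discrete[OF z] by (auto simp: islimpt_approachable)
    define r where "r = min r1 r2"
    have r: "r > 0" "ball z r \<subseteq> M" "ball z r \<inter> S \<subseteq> {z}"
      using r1 r2 by (force simp: r_def dist_commute)+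
    show ?thesis
    proof (cases "z \<in> S")
      case True
      have "f holomorphic_on ball z r - {z}"
        by (rule holomorphic_on_subset[OF hol]) (use r in auto)
      then obtain g where "g holomorphic_on ball z r" "\<forall>y\<in>ball z r - {z}. g y = f y"
        using holomorphic_on_extend_lim[of f "ball z r" z] r lim[of z] z True by auto
      then show ?thesis using r True by blast
    next
      case False
      have "f holomorphic_on ball z r"
        by (rule holomorphic_on_subset[OF hol]) (use r False in auto)
      then show ?thesis using r by blast
    qed
  qed
  then obtain r g where rg: "\<And>z. z \<in> M \<Longrightarrow> r z > 0 \<and> ball z (r z) \<subseteq> M \<and>
      ball z (r z) \<inter> S \<subseteq> {z} \<and> g z holomorphic_on ball z (r z) \<and>
      (\<forall>y\<in>ball z (r z) - S. g z y = f y)"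
    by metis
  define F where "F y = (if y \<in> S then g y y else f y)" for y
  have "F field_differentiable at z" if z: "z \<in> M" for z
  proof -
    have "F y = g z y" if "y \<in> ball z (r z)" for y
      using rg[OF z] that unfolding F_def by auto
    then have "F holomorphic_on ball z (r z)"
      using rg[OF z] holomorphic_cong by metis
    then show ?thesis
      using rg[OF z] by (meson centre_in_ball holomorphic_on_imp_differentiable_at open_ball)
  qed
  then have "F holomorphic_on M"
    by (simp add: field_differentiable_at_within holomorphic_on_def)
  then show ?thesis by (auto simp: F_def)
qed

text \<open>
  The uniform bound makes the Weierstrass test applicable with the majorant \<open>p x * B\<close>, so the
  sum is a locally uniform limit of finite sums of holomorphic functions.
\<close>

lemma holomorphic_on_weighted_infsum:
  fixes p :: "'x \<Rightarrow> real" and f :: "'x \<Rightarrow> complex \<Rightarrow> complex"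
  assumes p: "p summable_on X" "\<And>x. x \<in> X \<Longrightarrow> 0 \<le> p x" and "open U"
    and hol: "\<And>x. x \<in> X \<Longrightarrow> f x holomorphic_on U"
    and bound: "\<And>x \<xi>. x \<in> X \<Longrightarrow> \<xi> \<in> U \<Longrightarrow> norm (f x \<xi>) \<le> B"
  shows "(\<lambda>\<xi>. \<Sum>\<^sub>\<infinity>x\<in>X. of_real (p x) * f x \<xi>) holomorphic_on U"
proof -
  let ?F = "\<lambda>\<xi>. \<Sum>\<^sub>\<infinity>x\<in>X. of_real (p x) * f x \<xi>"
  have "?F field_differentiable at z" if "z \<in> U" for z
  proof -
    obtain r where r: "r > 0" "cball z r \<subseteq> U"
      using \<open>open U\<close> \<open>z \<in> U\<close> open_contains_cball by blast
    have hc: "(\<lambda>\<xi>. of_real (p x) * f x \<xi>) holomorphic_on cball z r" if "x \<in> X" for x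
      by (intro holomorphic_intros holomorphic_on_subset[OF hol[OF that] r(2)])
    have ev: "\<forall>\<^sub>F Y in finite_subsets_at_top X. continuous_on (cball z r) (\<lambda>\<xi>. \<Sum>x\<in>Y. of_real (p x) * f x \<xi>)
       \<and> (\<lambda>\<xi>. \<Sum>x\<in>Y. of_real (p x) * f x \<xi>) holomorphic_on ball z r"
      unfolding eventually_finite_subsets_at_top
    proof (intro exI conjI allI impI)
      fix Y assume "finite Y \<and> {} \<subseteq> Y \<and> Y \<subseteq> X"
      then have h: "(\<lambda>\<xi>. \<Sum>x\<in>Y. of_real (p x) * f x \<xi>) holomorphic_on cball z r"
        by (intro holomorphic_on_sum hc) auto
      show "continuous_on (cball z r) (\<lambda>\<xi>. \<Sum>x\<in>Y. of_real (p x) * f x \<xi>)"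
        using h by (rule holomorphic_on_imp_continuous_on)
      show "(\<lambda>\<xi>. \<Sum>x\<in>Y. of_real (p x) * f x \<xi>) holomorphic_on ball z r"
        using h by (rule holomorphic_on_subset) auto
    qed auto
    have "uniform_limit (cball z r) (\<lambda>Y \<xi>. \<Sum>x\<in>Y. of_real (p x) * f x \<xi>) ?F (finite_subsets_at_top X)"
    proof (rule Weierstrass_m_test_general)
      show "norm (of_real (p x) * f x \<xi>) \<le> p x * B" if "x \<in> X" "\<xi> \<in> cball z r" for x \<xi>
        using bound[of x \<xi>] that p(2)[of x] r(2) by (auto simp: norm_mult intro!: mult_mono)
      show "(\<lambda>x. p x * B) summable_on X"
        by (intro summable_on_cmult_left p)
    qed
    then have "?F holomorphic_on ball z r"
      by (rule holomorphic_uniform_limit[OF ev]) auto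
    then show ?thesis
      using r(1) by (meson centre_in_ball holomorphic_on_imp_differentiable_at open_ball)
  qed
  then show ?thesis
    by (simp add: field_differentiable_at_within holomorphic_on_def)
qed

section \<open>Weighted sums of products with simple poles\<close>

lemma weighted_summable:
  fixes p :: "'x \<Rightarrow> real" and f :: "'x \<Rightarrow> complex"
  assumes p: "p summable_on X" "\<And>x. x \<in> X \<Longrightarrow> 0 \<le> p x"
    and bound: "\<And>x. x \<in> X \<Longrightarrow> norm (f x) \<le> B"
  shows "(\<lambda>x. norm (of_real (p x) * f x)) summable_on X"
    and "norm (\<Sum>\<^sub>\<infinity>x\<in>X. of_real (p x) * f x) \<le> (\<Sum>\<^sub>\<infinity>x\<in>X. p x) * B"
proof -
  have le: "norm (of_real (p x) * f x) \<le> p x * B" if "x \<in> X" for x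
    using bound[OF that] p(2)[OF that] by (auto simp: norm_mult intro!: mult_mono)
  have s: "(\<lambda>x. p x * B) summable_on X"
    by (intro summable_on_cmult_left p)
  show *: "(\<lambda>x. norm (of_real (p x) * f x)) summable_on X"
    by (rule summable_on_comparison_test[OF s]) (use le in auto)
  have "norm (\<Sum>\<^sub>\<infinity>x\<in>X. of_real (p x) * f x) \<le> (\<Sum>\<^sub>\<infinity>x\<in>X. norm (of_real (p x) * f x))"
    using * by (rule norm_infsum_bound)
  also have "\<dots> \<le> (\<Sum>\<^sub>\<infinity>x\<in>X. p x * B)"
    by (rule infsum_mono[OF * s le])
  also have "\<dots> = (\<Sum>\<^sub>\<infinity>x\<in>X. p x) * B"
    by (simp add: infsum_cmult_left')
  finally show "norm (\<Sum>\<^sub>\<infinity>x\<in>X. of_real (p x) * f x) \<le> (\<Sum>\<^sub>\<infinity>x\<in>X. p x) * B" .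
qed

lemma norm_prod_one_plus_quotient_le:
  fixes \<kappa> :: complex
  assumes "\<delta> > 0" "\<And>i. i \<in> I \<Longrightarrow> \<delta> \<le> norm (\<xi> - a i)"
  shows "norm (\<Prod>i\<in>I. 1 + \<kappa> / (\<xi> - a i)) \<le> (1 + norm \<kappa> / \<delta>) ^ card I"
proof -
  have "norm (1 + \<kappa> / (\<xi> - a i)) \<le> 1 + norm \<kappa> / \<delta>" if "i \<in> I" for i
  proof -
    have "norm (\<kappa> / (\<xi> - a i)) \<le> norm \<kappa> / \<delta>"
      using assms(2)[OF that] assms(1) by (auto simp: norm_divide intro!: divide_left_mono mult_pos_pos)
    then show ?thesis
      using norm_triangle_ineq[of 1 "\<kappa> / (\<xi> - a i)"] by simp
  qed
  then show ?thesis
    unfolding prod_norm[symmetric] using prod_mono[of I "\<lambda>i. norm (1 + \<kappa> / (\<xi> - a i))" "\<lambda>_. 1 + norm \<kappa> / \<delta>"]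
    by (cases "finite I") auto
qed

text \<open>
  The points \<open>a i\<close> are distinct, so at most one factor of the product has a pole at \<open>m\<close>, and
  \<open>\<xi> - m\<close> removes it: \<open>(\<xi> - m) * (1 + \<kappa> / (\<xi> - m)) = \<xi> - m + \<kappa>\<close>. The bound on the disc depends
  on \<open>a\<close> only through the separation \<open>r\<close> and the number of points. That uniformity is what allows
  a summation over infinitely many tuples afterwards.
\<close>

lemma simple_poles_times_linear_factor:
  fixes a :: "'i \<Rightarrow> complex"
  assumes fin: "finite I" and inj: "inj_on a I" and r: "r > 0"
    and sep: "\<And>i. i \<in> I \<Longrightarrow> a i \<noteq> m \<Longrightarrow> 2 * r \<le> dist (a i) m"
  shows "\<exists>h. h holomorphic_on ball m r \<and>
           (\<forall>\<xi>\<in>ball m r. norm (h \<xi>) \<le> (r + norm \<kappa>) * (1 + norm \<kappa> / r) ^ card I) \<and>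
           (\<forall>\<xi>\<in>ball m r - {m}. (\<xi> - m) * (\<Prod>i\<in>I. 1 + \<kappa> / (\<xi> - a i)) = h \<xi>) \<and>
           h m = (\<Sum>i\<in>I. if a i = m then \<kappa> * (\<Prod>j\<in>I - {i}. 1 + \<kappa> / (m - a j)) else 0)"
proof -
  \<comment> \<open>The factors without a pole at the centre stay bounded on the disc.\<close>
  define J where "J = {i\<in>I. a i \<noteq> m}"
  define q where "q \<xi> = (\<Prod>i\<in>J. 1 + \<kappa> / (\<xi> - a i))" for \<xi>
  have J: "finite J" "card J \<le> card I"
    unfolding J_def using fin by (auto intro: card_mono)
  have far: "r \<le> norm (\<xi> - a i)" if "i \<in> J" "\<xi> \<in> ball m r" for i \<xi>
  proof -
    have "2 * r \<le> dist (a i) m" using sep that by (auto simp: J_def)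
    moreover have "dist (a i) m \<le> dist (a i) \<xi> + dist \<xi> m" by (rule dist_triangle)
    ultimately show ?thesis using that(2) by (simp add: dist_norm norm_minus_commute)
  qed
  have qhol: "q holomorphic_on ball m r"
    unfolding q_def using far r by (intro holomorphic_intros) force
  have qle: "norm (q \<xi>) \<le> (1 + norm \<kappa> / r) ^ card I" if "\<xi> \<in> ball m r" for \<xi>
  proof -
    have "norm (q \<xi>) \<le> (1 + norm \<kappa> / r) ^ card J"
      unfolding q_def by (rule norm_prod_one_plus_quotient_le) (use r far that in auto)
    also have "\<dots> \<le> (1 + norm \<kappa> / r) ^ card I"
      using J(2) r by (intro power_increasing) auto
    finally show ?thesis .
  qed
  \<comment> \<open>The linear prefactor is \<open>\<xi> - m + \<kappa>\<close> if some point equals \<open>m\<close> and \<open>\<xi> - m\<close> otherwise.\<close>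
  have "\<exists>c. norm c \<le> norm \<kappa> \<and>
     (\<forall>\<xi>. \<xi> \<noteq> m \<longrightarrow> (\<xi> - m) * (\<Prod>i\<in>I. 1 + \<kappa> / (\<xi> - a i)) = (\<xi> - m + c) * q \<xi>) \<and>
     c * q m = (\<Sum>i\<in>I. if a i = m then \<kappa> * (\<Prod>j\<in>I - {i}. 1 + \<kappa> / (m - a j)) else 0)"
  proof (cases "\<exists>i\<in>I. a i = m")
    case True
    then obtain k where k: "k \<in> I" "a k = m" by blast
    have eq: "a i = m \<longleftrightarrow> i = k" if "i \<in> I" for i
      using k inj that by (auto dest: inj_onD)
    have Jk: "J = I - {k}" using eq k by (auto simp: J_def)
    have "(\<xi> - m) * (\<Prod>i\<in>I. 1 + \<kappa> / (\<xi> - a i)) = (\<xi> - m + \<kappa>) * q \<xi>" if "\<xi> \<noteq> m" for \<xi>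
      unfolding q_def Jk using prod.remove[OF fin k(1), of "\<lambda>i. 1 + \<kappa> / (\<xi> - a i)"] k that
      by (simp add: field_simps)
    moreover have "(\<Sum>i\<in>I. if a i = m then \<kappa> * (\<Prod>j\<in>I - {i}. 1 + \<kappa> / (m - a j)) else 0) =
        (\<Sum>i\<in>I. if i = k then \<kappa> * q m else 0)"
      by (rule sum.cong) (auto simp: eq q_def Jk)
    ultimately show ?thesis
      using fin k by (intro exI[of _ \<kappa>]) (auto simp: sum.delta)
  next
    case False
    then have "J = I" by (auto simp: J_def)
    with False show ?thesis by (intro exI[of _ 0]) (auto simp: q_def intro!: sum.neutral)
  qed
  then obtain c where c: "norm c \<le> norm \<kappa>"
      "\<And>\<xi>. \<xi> \<noteq> m \<Longrightarrow> (\<xi> - m) * (\<Prod>i\<in>I. 1 + \<kappa> / (\<xi> - a i)) = (\<xi> - m + c) * q \<xi>"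
      "c * q m = (\<Sum>i\<in>I. if a i = m then \<kappa> * (\<Prod>j\<in>I - {i}. 1 + \<kappa> / (m - a j)) else 0)"
    by blast
  show ?thesis
  proof (intro exI[of _ "\<lambda>\<xi>. (\<xi> - m + c) * q \<xi>"] conjI ballI)
    show "(\<lambda>\<xi>. (\<xi> - m + c) * q \<xi>) holomorphic_on ball m r"
      by (intro holomorphic_intros qhol)
    fix \<xi> assume \<xi>: "\<xi> \<in> ball m r"
    have "norm (\<xi> - m + c) \<le> r + norm \<kappa>"
      using norm_triangle_ineq[of "\<xi> - m" c] c(1) \<xi> by (simp add: dist_norm norm_minus_commute)
    then show "norm ((\<xi> - m + c) * q \<xi>) \<le> (r + norm \<kappa>) * (1 + norm \<kappa> / r) ^ card I"
      using qle[OF \<xi>] r unfolding norm_mult by (intro mult_mono) auto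
  qed (use c in auto)
qed

text \<open>
  Both expectations in the Nekrasov function are weighted sums of products with simple poles. The
  two differ only in the position of the poles and in the sign of the residue. Their analysis
  rests on the summability of the weights, the distinctness of the entries of each tuple, and the
  discreteness of a set \<open>S\<close> that contains the entries of all tuples.
\<close>

locale weighted_tuples =
  fixes X :: "'x set" and p :: "'x \<Rightarrow> real" and I :: "'i set"
    and a :: "'x \<Rightarrow> 'i \<Rightarrow> complex" and S :: "complex set"
  assumes p_nonneg: "\<And>x. x \<in> X \<Longrightarrow> 0 \<le> p x" and p_summable: "p summable_on X"
    and finite_I: "finite I" and inj_a: "\<And>x. x \<in> X \<Longrightarrow> inj_on (a x) I"
    and a_in_S: "\<And>x i. x \<in> X \<Longrightarrow> i \<in> I \<Longrightarrow> a x i \<in> S"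
    and no_limpt: "\<And>z. \<not> z islimpt S"
begin

definition mean :: "complex \<Rightarrow> complex \<Rightarrow> complex" where
  "mean \<kappa> \<xi> = (\<Sum>\<^sub>\<infinity>x\<in>X. of_real (p x) * (\<Prod>i\<in>I. 1 + \<kappa> / (\<xi> - a x i)))"

definition mean_residue :: "complex \<Rightarrow> complex \<Rightarrow> complex" where
  "mean_residue \<kappa> m =
     (\<Sum>i\<in>I. \<Sum>\<^sub>\<infinity>x | x \<in> X \<and> a x i = m. of_real (p x) * (\<kappa> * (\<Prod>j\<in>I - {i}. 1 + \<kappa> / (m - a x j))))"

lemma norm_mean_le:
  assumes "\<delta> > 0" "\<And>z. z \<in> S \<Longrightarrow> \<delta> \<le> dist \<xi> z"
  shows "norm (mean \<kappa> \<xi>) \<le> (\<Sum>\<^sub>\<infinity>x\<in>X. p x) * (1 + norm \<kappa> / \<delta>) ^ card I"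
  unfolding mean_def
  by (intro weighted_summable(2) p_summable p_nonneg norm_prod_one_plus_quotient_le)
     (use assms a_in_S in \<open>auto simp: dist_norm\<close>)

lemma separation:
  obtains r where "r > 0" "\<And>y. y \<in> S \<Longrightarrow> y \<noteq> z \<Longrightarrow> 2 * r \<le> dist y z"
proof -
  obtain r where "r > 0" "\<And>y. y \<in> S \<Longrightarrow> y \<noteq> z \<Longrightarrow> \<not> dist y z < r"
    using no_limpt[of z] by (auto simp: islimpt_approachable)
  then show ?thesis using that[of "r / 2"] by force
qed

lemma mean_holomorphic: "mean \<kappa> holomorphic_on - S"
proof -
  have "mean \<kappa> field_differentiable at z" if z: "z \<notin> S" for z
  proof -
    obtain r where r: "r > 0" "\<And>y. y \<in> S \<Longrightarrow> y \<noteq> z \<Longrightarrow> 2 * r \<le> dist y z"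
      by (rule separation[of z]) blast
    have far: "r \<le> norm (\<xi> - y)" if "y \<in> S" "\<xi> \<in> ball z r" for \<xi> y
    proof -
      have "2 * r \<le> dist y z" using r(2) z that by auto
      moreover have "dist y z \<le> dist y \<xi> + dist \<xi> z" by (rule dist_triangle)
      ultimately show ?thesis using that(2) by (simp add: dist_norm norm_minus_commute)
    qed
    have "mean \<kappa> holomorphic_on ball z r"
      unfolding mean_def
    proof (rule holomorphic_on_weighted_infsum[OF p_summable p_nonneg])
      fix x assume x: "x \<in> X"
      show "(\<lambda>\<xi>. \<Prod>i\<in>I. 1 + \<kappa> / (\<xi> - a x i)) holomorphic_on ball z r"
        using far[OF a_in_S[OF x]] r(1) by (intro holomorphic_intros) force
      show "norm (\<Prod>i\<in>I. 1 + \<kappa> / (\<xi> - a x i)) \<le> (1 + norm \<kappa> / r) ^ card I"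
        if "\<xi> \<in> ball z r" for \<xi>
        by (rule norm_prod_one_plus_quotient_le) (use r far a_in_S[OF x] that in auto)
    qed auto
    then show ?thesis
      using r(1) by (meson centre_in_ball holomorphic_on_imp_differentiable_at open_ball)
  qed
  then show ?thesis
    by (simp add: field_differentiable_at_within holomorphic_on_def)
qed

text \<open>
  Multiplied by \<open>\<xi> - m\<close>, every summand extends holomorphically to one and the same disc around
  \<open>m\<close>, with a common bound. Hence so does the sum, and its value at \<open>m\<close> is the sum of the values of
  the summands. This settles the interchange of the limit with the sum.
\<close>

lemma mean_simple_pole: "((\<lambda>\<xi>. (\<xi> - m) * mean \<kappa> \<xi>) \<longlongrightarrow> mean_residue \<kappa> m) (at m)"
proof -
  obtain r where r: "r > 0" "\<And>y. y \<in> S \<Longrightarrow> y \<noteq> m \<Longrightarrow> 2 * r \<le> dist y m"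
    by (rule separation[of m]) blast
  define B where "B = (r + norm \<kappa>) * (1 + norm \<kappa> / r) ^ card I"
  define c where "c x i = \<kappa> * (\<Prod>j\<in>I - {i}. 1 + \<kappa> / (m - a x j))" for x i
  have "\<forall>x\<in>X. \<exists>h. h holomorphic_on ball m r \<and> (\<forall>\<xi>\<in>ball m r. norm (h \<xi>) \<le> B) \<and>
      (\<forall>\<xi>\<in>ball m r - {m}. (\<xi> - m) * (\<Prod>i\<in>I. 1 + \<kappa> / (\<xi> - a x i)) = h \<xi>) \<and>
      h m = (\<Sum>i\<in>I. if a x i = m then c x i else 0)"
    unfolding B_def c_def
    by (intro ballI simple_poles_times_linear_factor finite_I inj_a r a_in_S)
  from bchoice[OF this] obtain h where
    h: "\<And>x. x \<in> X \<Longrightarrow> h x holomorphic_on ball m r"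
       "\<And>x \<xi>. x \<in> X \<Longrightarrow> \<xi> \<in> ball m r \<Longrightarrow> norm (h x \<xi>) \<le> B"
       "\<And>x \<xi>. x \<in> X \<Longrightarrow> \<xi> \<in> ball m r - {m} \<Longrightarrow> (\<xi> - m) * (\<Prod>i\<in>I. 1 + \<kappa> / (\<xi> - a x i)) = h x \<xi>"
       "\<And>x. x \<in> X \<Longrightarrow> h x m = (\<Sum>i\<in>I. if a x i = m then c x i else 0)"
    by blast
  define G where "G \<xi> = (\<Sum>\<^sub>\<infinity>x\<in>X. of_real (p x) * h x \<xi>)" for \<xi>
  have "G holomorphic_on ball m r"
    unfolding G_def by (rule holomorphic_on_weighted_infsum[OF p_summable p_nonneg]) (use h in auto)
  then have "isCont G m"
    using r(1) by (meson centre_in_ball continuous_on_eq_continuous_at holomorphic_on_imp_continuous_on open_ball)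
  then have lim: "(G \<longlongrightarrow> G m) (at m)" by (simp add: isCont_def)
  have eq: "G \<xi> = (\<xi> - m) * mean \<kappa> \<xi>" if "\<xi> \<in> ball m r" "\<xi> \<noteq> m" for \<xi>
  proof -
    have "G \<xi> = (\<Sum>\<^sub>\<infinity>x\<in>X. (\<xi> - m) * (of_real (p x) * (\<Prod>i\<in>I. 1 + \<kappa> / (\<xi> - a x i))))"
      unfolding G_def by (rule infsum_cong) (use h(3) that in \<open>auto simp: mult_ac\<close>)
    then show ?thesis
      unfolding mean_def by (simp add: infsum_cmult_right')
  qed
  have "\<forall>\<^sub>F \<xi> in at m. G \<xi> = (\<xi> - m) * mean \<kappa> \<xi>"
    using eq r(1) by (auto simp: eventually_at intro!: exI[of _ r] simp: dist_commute)
  with lim have "((\<lambda>\<xi>. (\<xi> - m) * mean \<kappa> \<xi>) \<longlongrightarrow> G m) (at m)"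
    by (rule Lim_transform_eventually)
  moreover have "G m = mean_residue \<kappa> m"
  proof -
    have cb: "norm (if a x i = m then c x i else 0) \<le> norm \<kappa> * (1 + norm \<kappa> / r) ^ card (I - {i})"
      if x: "x \<in> X" and i: "i \<in> I" for x i
    proof (cases "a x i = m")
      case True
      have "r \<le> norm (m - a x j)" if "j \<in> I - {i}" for j
      proof -
        have "a x j \<noteq> m" using inj_onD[OF inj_a[OF x], of j i] i that True by auto
        then have "2 * r \<le> dist (a x j) m" using r(2) a_in_S[OF x] that by blast
        then show ?thesis using r(1) by (simp add: dist_norm norm_minus_commute)
      qed
      then have "norm (\<Prod>j\<in>I - {i}. 1 + \<kappa> / (m - a x j)) \<le> (1 + norm \<kappa> / r) ^ card (I - {i})"
        using r by (intro norm_prod_one_plus_quotient_le) auto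
      then show ?thesis
        using True by (auto simp: c_def norm_mult intro!: mult_left_mono)
    next
      case False
      then show ?thesis using r by simp
    qed
    have sm: "(\<lambda>x. of_real (p x) * (if a x i = m then c x i else 0)) summable_on X" if "i \<in> I" for i
      by (rule abs_summable_summable[OF weighted_summable(1)[OF p_summable p_nonneg cb]]) (use that in auto)
    have "G m = (\<Sum>\<^sub>\<infinity>x\<in>X. \<Sum>i\<in>I. of_real (p x) * (if a x i = m then c x i else 0))"
      unfolding G_def by (rule infsum_cong) (simp add: h(4) sum_distrib_left)
    also have "\<dots> = (\<Sum>i\<in>I. \<Sum>\<^sub>\<infinity>x\<in>X. of_real (p x) * (if a x i = m then c x i else 0))"
    proof -
      have "((\<lambda>x. \<Sum>i\<in>K. of_real (p x) * (if a x i = m then c x i else 0)) has_sum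
          (\<Sum>i\<in>K. \<Sum>\<^sub>\<infinity>x\<in>X. of_real (p x) * (if a x i = m then c x i else 0))) X"
        if "finite K" "K \<subseteq> I" for K
        using that
      proof (induction K)
        case (insert k K)
        then show ?case
          using has_sum_add[OF has_sum_infsum[OF sm[of k]] insert.IH] by simp
      qed simp
      from this[OF finite_I order_refl] show ?thesis by (rule infsumI)
    qed
    also have "\<dots> = mean_residue \<kappa> m"
      unfolding mean_residue_def c_def by (intro sum.cong refl infsum_cong_neutral) auto
    finally show ?thesis .
  qed
  ultimately show ?thesis by simp
qed

end

section \<open>Integer translates of a finite set\<close>

definition int_translates :: "real set \<Rightarrow> real set" where
  "int_translates A = (\<Union>c\<in>A. range (\<lambda>k::int. of_int k + c))"

lemma int_translates_no_limpt:
  assumes "finite A"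
  shows "\<not> (z :: complex) islimpt of_real ` int_translates A"
proof -
  have "of_real ` int_translates A \<inter> ball z 1 \<subseteq>
      (\<Union>c\<in>A. (\<lambda>k::int. of_real (of_int k + c)) ` {\<lfloor>Re z - 1 - c\<rfloor>..\<lceil>Re z + 1 - c\<rceil>})"
  proof
    fix y assume y: "y \<in> of_real ` int_translates A \<inter> ball z 1"
    then obtain c k where ck: "c \<in> A" "y = of_real (of_int k + c)"
      by (auto simp: int_translates_def)
    have "\<bar>Re z - Re y\<bar> \<le> dist z y"
      using abs_Re_le_cmod[of "z - y"] by (simp add: dist_norm)
    then have "\<bar>Re z - (of_int k + c)\<bar> < 1" using y ck by auto
    then have "k \<in> {\<lfloor>Re z - 1 - c\<rfloor>..\<lceil>Re z + 1 - c\<rceil>}" by (simp add: abs_if split: if_splits) linarith+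
    then show "y \<in> (\<Union>c\<in>A. (\<lambda>k::int. of_real (of_int k + c)) ` {\<lfloor>Re z - 1 - c\<rfloor>..\<lceil>Re z + 1 - c\<rceil>})"
      using ck by blast
  qed
  then have "finite (of_real ` int_translates A \<inter> ball z 1)"
    by (rule finite_subset) (use assms in auto)
  then show ?thesis
    unfolding islimpt_eq_infinite_ball by (metis zero_less_one)
qed

text \<open>
  A point of norm \<open>n + \<rho>\<close> is at least as far from a real number \<open>x\<close> as \<open>n + \<rho>\<close> is from \<open>\<bar>x\<bar>\<close>. The
  set of the numbers \<open>\<plusminus>x\<close> is invariant under integer translations, so only the distance of \<open>\<rho>\<close> to
  it matters; it is countable, so some \<open>\<rho>\<close> lies outside it, and discrete, so that the distance is
  positive.
\<close>

lemma circles_avoiding_int_translates: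
  assumes "finite A"
  shows "\<exists>\<rho> \<delta>. 0 < \<rho> \<and> \<rho> < 1 \<and> 0 < \<delta> \<and>
    (\<forall>n. \<forall>z::complex. norm z = real n + \<rho> \<longrightarrow> (\<forall>y\<in>of_real ` int_translates A. \<delta> \<le> dist z y))"
proof -
  define B where "B = A \<union> uminus ` A"
  have "finite B" using assms by (simp add: B_def)
  have "countable (int_translates B)"
    unfolding int_translates_def by (rule countable_UN[OF countable_finite[OF \<open>finite B\<close>]]) auto
  then have "\<not> {0<..<1} \<subseteq> int_translates B"
    using uncountable_open_interval[of "0::real" 1] by (auto dest: countable_subset)
  then obtain \<rho> where "\<rho> \<in> {0<..<1}" and "\<rho> \<notin> int_translates B"
    by blast
  then have \<rho>: "0 < \<rho>" "\<rho> < 1" "\<rho> \<notin> int_translates B"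
    by auto
  obtain \<delta> where \<delta>: "\<delta> > 0"
      "\<forall>y\<in>of_real ` int_translates B. \<not> (y \<noteq> complex_of_real \<rho> \<and> dist y (of_real \<rho>) < \<delta>)"
    using int_translates_no_limpt[OF \<open>finite B\<close>, of "of_real \<rho>"]
    unfolding islimpt_approachable by blast
  have far: "\<delta> \<le> \<bar>\<rho> - x\<bar>" if "x \<in> int_translates B" for x
  proof -
    have "x \<noteq> \<rho>" using that \<rho>(3) by auto
    with \<delta>(2) that have "\<not> dist (complex_of_real x) (of_real \<rho>) < \<delta>" by auto
    then show ?thesis by (simp add: dist_real_def)
  qed
  show ?thesis
  proof (rule exI[of _ \<rho>], rule exI[of _ \<delta>], intro conjI allI impI ballI \<rho>(1,2) \<delta>(1))
    fix n :: nat and z y :: complex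
    assume z: "norm z = real n + \<rho>" and "y \<in> of_real ` int_translates A"
    then obtain c k where ck: "c \<in> A" "y = of_real (of_int k + c)"
      by (auto simp: int_translates_def)
    have 1: "of_int (k - int n) + c \<in> int_translates B"
      unfolding int_translates_def B_def using ck(1) by blast
    have 2: "of_int (- k - int n) + - c \<in> int_translates B"
      unfolding int_translates_def B_def using ck(1) by blast
    have "\<bar>norm z - norm y\<bar> \<le> dist z y" by (simp add: dist_norm norm_triangle_ineq3)
    moreover have "norm y = \<bar>of_int k + c\<bar>" unfolding ck by (rule norm_of_real)
    ultimately show "\<delta> \<le> dist z y"
      using far[OF 1] far[OF 2] z by (auto simp: abs_if split: if_splits)
  qed
qed

section \<open>Entire functions of polynomial growth\<close>

lemma norm_poly_le:
  fixes p :: "complex poly"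
  assumes "degree p \<le> d" "1 \<le> norm z"
  shows "norm (poly p z) \<le> (\<Sum>i\<le>d. norm (coeff p i)) * norm z ^ d"
proof -
  have "poly p z = (\<Sum>i\<le>d. coeff p i * z ^ i)"
    using assms(1) by (rule poly_as_sum_of_monoms'[THEN arg_cong[where f="\<lambda>p. poly p z"], symmetric, unfolded poly_sum poly_monom])
  also have "norm \<dots> \<le> (\<Sum>i\<le>d. norm (coeff p i) * norm z ^ d)"
    by (rule sum_norm_le) (use assms(2) in \<open>auto simp: norm_mult norm_power intro!: mult_left_mono power_increasing\<close>)
  finally show ?thesis by (simp add: sum_distrib_right)
qed

text \<open>
  Consecutive circles have radii at distance one, so the maximum principle turns the bounds on the
  circles into a bound at every point, at the cost of a constant factor, and the theorem of
  Liouville for functions of polynomial growth applies.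
\<close>

lemma polynomial_of_growth_on_circles:
  assumes hol: "F holomorphic_on UNIV" and \<rho>: "0 < \<rho>" "\<rho> < 1"
    and bound: "\<And>n z. norm z = real n + \<rho> \<Longrightarrow> 1 \<le> norm z \<Longrightarrow> norm (F z) \<le> K * norm z ^ d"
  shows "\<exists>r :: complex poly. degree r \<le> d \<and> (\<forall>z. F z = poly r z)"
proof -
  have growth: "norm (F z) \<le> (\<bar>K\<bar> * 3 ^ d) * norm z ^ d" if z: "1 \<le> norm z" for z
  proof -
    \<comment> \<open>The circle of radius \<open>R\<close> encloses \<open>z\<close>, and \<open>R\<close> is at most \<open>3 * norm z\<close> because \<open>1 \<le> norm z\<close>.\<close>
    define n where "n = nat \<lceil>norm z\<rceil>"
    define R where "R = real n + \<rho>"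
    have n: "norm z \<le> real n" "real n < norm z + 1" unfolding n_def using z by linarith+
    then have R: "norm z < R" "R \<le> 3 * norm z" "0 < R" "1 \<le> R" unfolding R_def using \<rho> z by linarith+
    have "norm (F z) \<le> K * R ^ d"
    proof (rule maximum_modulus_frontier[of F "ball 0 R"])
      show "F holomorphic_on interior (ball 0 R)" using hol by (rule holomorphic_on_subset) auto
      show "continuous_on (closure (ball 0 R)) F"
        using hol by (meson continuous_on_subset holomorphic_on_imp_continuous_on subset_UNIV)
      show "norm (F y) \<le> K * R ^ d" if "y \<in> frontier (ball 0 R)" for y
        using bound[of y n] that R by (auto simp: R_def)
    qed (use R in auto)
    also have "\<dots> \<le> \<bar>K\<bar> * (3 * norm z) ^ d"
      using R by (intro mult_mono power_mono) auto
    finally show ?thesis by (simp add: power_mult_distrib mult_ac)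
  qed
  define r where "r = (\<Sum>k\<le>d. monom ((deriv ^^ k) F 0 / fact k) k)"
  have "degree r \<le> d"
    unfolding r_def by (intro degree_sum_le) (auto intro: order_trans[OF degree_monom_le])
  moreover have "F z = poly r z" for z
    using Liouville_polynomial[OF hol growth] by (simp add: r_def poly_sum poly_monom)
  ultimately show ?thesis by blast
qed

section \<open>Configurations and their single steps\<close>

lemma configsI:
  assumes "\<theta> > 0" "l \<in> extensional {1..N}" "mono_on {1..N} (lam :: nat \<Rightarrow> int)"
    and "\<And>i. i \<in> {1..N} \<Longrightarrow> l i = of_int (lam i) + \<theta> * real i"
  shows "l \<in> configs N \<theta>"
proof -
  have "strict_mono_on {1..N} l"
  proof (rule strict_mono_onI)
    fix i j assume ij: "i \<in> {1..N}" "j \<in> {1..N}" "i < j"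
    then have "lam i \<le> lam j" using assms(3) by (simp add: mono_on_def)
    moreover have "\<theta> * real i < \<theta> * real j" using ij assms(1) by simp
    ultimately show "l i < l j" using assms(4) ij by (simp add: add_le_less_mono)
  qed
  then show ?thesis using assms unfolding configs_def by blast
qed

lemma configs_gap:
  assumes "\<theta> > 0" "l \<in> configs N \<theta>" "i \<in> {1..N}" "j \<in> {1..N}" "i < j"
  shows "\<theta> \<le> l j - l i"
proof -
  obtain lam :: "nat \<Rightarrow> int" where lam: "mono_on {1..N} lam"
      "\<And>i. i \<in> {1..N} \<Longrightarrow> l i = of_int (lam i) + \<theta> * real i"
    using assms(2) unfolding configs_def by blast
  have "lam i \<le> lam j" using lam(1) assms by (simp add: mono_on_def)
  moreover have "\<theta> * (real i + 1) \<le> \<theta> * real j" using assms by (intro mult_left_mono) auto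
  ultimately show ?thesis using lam(2) assms(3,4) by (simp add: algebra_simps)
qed

text \<open>
  Moving the \<open>i\<close>-th particle one step down can only be prevented by its left neighbour, and only
  if the two integers \<open>\<lambda>\<close> agree, that is, if the two particles are exactly \<open>\<theta>\<close> apart. At such a
  configuration one of the factors in the residue vanishes. The same holds for a step up and the
  right neighbour.
\<close>

lemma configs_lower_blocked:
  assumes "\<theta> > 0" "l \<in> configs N \<theta>" "i \<in> {1..N}" "l(i := l i - 1) \<notin> configs N \<theta>"
  shows "\<exists>j\<in>{1..N} - {i}. l i - l j = \<theta>"
proof (rule ccontr)
  assume free: "\<not> ?thesis"
  obtain lam :: "nat \<Rightarrow> int" where lam: "l \<in> extensional {1..N}" "mono_on {1..N} lam"
      "\<And>i. i \<in> {1..N} \<Longrightarrow> l i = of_int (lam i) + \<theta> * real i"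
    using assms(2) unfolding configs_def by blast
  have below: "lam j \<le> lam i - 1" if "j \<in> {1..N}" "j < i" for j
  proof -
    have i1: "i - 1 \<in> {1..N} - {i}" using that assms(3) by auto
    then have "l i - l (i - 1) \<noteq> \<theta>" using free by blast
    moreover have "l i - l (i - 1) = of_int (lam i) - of_int (lam (i - 1)) + \<theta> * (real i - real (i - 1))"
      using i1 lam(3)[OF assms(3)] lam(3)[of "i - 1"] by (simp add: right_diff_distrib)
    moreover have "real i - real (i - 1) = 1" using assms(3) by auto
    ultimately have "lam (i - 1) \<noteq> lam i" by fastforce
    moreover have "lam j \<le> lam (i - 1)" "lam (i - 1) \<le> lam i"
      using lam(2) i1 that assms(3) by (auto simp: mono_on_def)
    ultimately show ?thesis by linarith
  qed
  have "mono_on {1..N} (lam(i := lam i - 1))"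
  proof (rule mono_onI)
    fix r s assume rs: "r \<in> {1..N}" "s \<in> {1..N}" "r \<le> s"
    then have "lam r \<le> lam s" using lam(2) by (simp add: mono_on_def)
    then show "(lam(i := lam i - 1)) r \<le> (lam(i := lam i - 1)) s"
      using below[of r] rs by auto
  qed
  then have "l(i := l i - 1) \<in> configs N \<theta>"
    using lam assms by (intro configsI) (auto simp: extensional_def)
  with assms(4) show False by contradiction
qed

lemma configs_raise_blocked:
  assumes "\<theta> > 0" "l \<in> configs N \<theta>" "i \<in> {1..N}" "l(i := l i + 1) \<notin> configs N \<theta>"
  shows "\<exists>j\<in>{1..N} - {i}. l j - l i = \<theta>"
proof (rule ccontr)
  assume free: "\<not> ?thesis"
  obtain lam :: "nat \<Rightarrow> int" where lam: "l \<in> extensional {1..N}" "mono_on {1..N} lam"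
      "\<And>i. i \<in> {1..N} \<Longrightarrow> l i = of_int (lam i) + \<theta> * real i"
    using assms(2) unfolding configs_def by blast
  have above: "lam i + 1 \<le> lam j" if "j \<in> {1..N}" "i < j" for j
  proof -
    have i1: "Suc i \<in> {1..N} - {i}" using that assms(3) by auto
    then have "lam (Suc i) \<noteq> lam i"
      using free lam(3)[of i] lam(3)[of "Suc i"] assms(3) that by (auto simp: algebra_simps)
    moreover have "lam (Suc i) \<le> lam j" "lam i \<le> lam (Suc i)"
      using lam(2) i1 that assms(3) by (auto simp: mono_on_def)
    ultimately show ?thesis by linarith
  qed
  have "mono_on {1..N} (lam(i := lam i + 1))"
  proof (rule mono_onI)
    fix r s assume rs: "r \<in> {1..N}" "s \<in> {1..N}" "r \<le> s"
    then have "lam r \<le> lam s" using lam(2) by (simp add: mono_on_def)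
    then show "(lam(i := lam i + 1)) r \<le> (lam(i := lam i + 1)) s"
      using above[of s] rs by auto
  qed
  then have "l(i := l i + 1) \<in> configs N \<theta>"
    using lam assms by (intro configsI) (auto simp: extensional_def)
  with assms(4) show False by contradiction
qed

lemma nekrasov_sing_subset:
  "nekrasov_sing N \<theta> \<subseteq> of_real ` int_translates ((\<lambda>i. \<theta> * real i) ` {1..N})"
proof
  fix y assume "y \<in> nekrasov_sing N \<theta>"
  then obtain l i where li: "l \<in> configs N \<theta>" "i \<in> {1..N}" "y = of_real (l i) \<or> y = of_real (l i + 1)"
    by (auto simp: nekrasov_sing_def)
  then obtain k :: int where k: "l i = of_int k + \<theta> * real i"
    by (auto simp: configs_def)
  have "l i \<in> int_translates ((\<lambda>i. \<theta> * real i) ` {1..N})"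
    unfolding k int_translates_def using li(2) by blast
  moreover have "l i + 1 = of_int (k + 1) + \<theta> * real i" by (simp add: k)
  then have "l i + 1 \<in> int_translates ((\<lambda>i. \<theta> * real i) ` {1..N})"
    unfolding int_translates_def using li(2) by blast
  ultimately show "y \<in> of_real ` int_translates ((\<lambda>i. \<theta> * real i) ` {1..N})"
    using li(3) by blast
qed

lemma nekrasov_sing_no_limpt: "\<not> z islimpt nekrasov_sing N \<theta>"
  using islimpt_subset[OF _ nekrasov_sing_subset] int_translates_no_limpt by blast

section \<open>The interaction under a single step\<close>

definition pair_factor :: "real \<Rightarrow> real \<Rightarrow> real" where
  "pair_factor \<theta> x = Gamma (x + 1) * Gamma (x + \<theta>) / (Gamma x * Gamma (x + 1 - \<theta>))"

lemma pair_factor_pos: "0 < \<theta> \<Longrightarrow> \<theta> \<le> x \<Longrightarrow> 0 < pair_factor \<theta> x"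
  unfolding pair_factor_def by (intro divide_pos_pos mult_pos_pos Gamma_real_pos) auto

text \<open>
  By the functional equation of the Gamma function, raising the distance of two particles from
  \<open>x\<close> to \<open>x + 1\<close> multiplies their interaction by
  \<open>(x + 1) * (x + \<theta>) / (x * (x + 1 - \<theta>))\<close>. This rational function is the quotient of the factors
  \<open>1 + \<theta> / x\<close> and \<open>1 - \<theta> / (x + 1)\<close>, which is the reason for the form of the products in the
  Nekrasov function.
\<close>

lemma pair_factor_step:
  assumes "0 < \<theta>" "\<theta> \<le> x"
  shows "pair_factor \<theta> x * (1 + \<theta> / x) = pair_factor \<theta> (x + 1) * (1 - \<theta> / (x + 1))"
proof -
  have step: "Gamma (y + 1) = y * Gamma y" if "y > 0" for y :: real
    using that by (intro Gamma_plus1) (auto dest: nonpos_Ints_nonpos)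
  have G: "Gamma (x + 1 + 1) = (x + 1) * Gamma (x + 1)" "Gamma (x + 1) = x * Gamma x"
      "Gamma (x + 1 + \<theta>) = (x + \<theta>) * Gamma (x + \<theta>)"
      "Gamma (x + 1 + 1 - \<theta>) = (x + 1 - \<theta>) * Gamma (x + 1 - \<theta>)"
    using assms step[of "x + 1"] step[of x] step[of "x + \<theta>"] step[of "x + 1 - \<theta>"]
    by (simp_all add: add_ac add_diff_eq diff_add_eq)
  have "Gamma x > 0" "Gamma (x + 1 - \<theta>) > 0" using assms by (auto intro: Gamma_real_pos)
  then show ?thesis
    unfolding pair_factor_def G using assms by (simp add: divide_simps)
qed

lemma prod_pairs_remove:
  fixes g :: "nat \<Rightarrow> nat \<Rightarrow> 'a::comm_monoid_mult"
  assumes i: "i \<in> {1..N}"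
  shows "(\<Prod>a\<in>{1..N}. \<Prod>b\<in>{a<..N}. g a b) =
           (\<Prod>a\<in>{1..N} - {i}. \<Prod>b\<in>{a<..N} - {i}. g a b) *
           (\<Prod>j\<in>{1..N} - {i}. if i < j then g i j else g j i)"
proof -
  have row: "(\<Prod>b\<in>{a<..N}. g a b) = (if a < i then g a i else 1) * (\<Prod>b\<in>{a<..N} - {i}. g a b)" for a
    using i by (cases "a < i") (auto simp: prod.remove)
  have "(\<Prod>b\<in>{i<..N}. g i b) = (\<Prod>j\<in>{1..N} - {i}. if i < j then g i j else 1)"
    using i by (intro prod.mono_neutral_cong_left) auto
  moreover have "(\<Prod>a\<in>{1..N} - {i}. \<Prod>b\<in>{a<..N}. g a b) =
     (\<Prod>a\<in>{1..N} - {i}. if a < i then g a i else 1) * (\<Prod>a\<in>{1..N} - {i}. \<Prod>b\<in>{a<..N} - {i}. g a b)"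
    unfolding row prod.distrib ..
  ultimately have "(\<Prod>a\<in>{1..N}. \<Prod>b\<in>{a<..N}. g a b) =
     (\<Prod>a\<in>{1..N} - {i}. \<Prod>b\<in>{a<..N} - {i}. g a b) *
     (\<Prod>j\<in>{1..N} - {i}. (if i < j then g i j else 1) * (if j < i then g j i else 1))"
    unfolding prod.remove[OF finite_atLeastAtMost i, of "\<lambda>a. \<Prod>b\<in>{a<..N}. g a b"] prod.distrib
    by (simp add: mult_ac)
  also have "(\<Prod>j\<in>{1..N} - {i}. (if i < j then g i j else 1) * (if j < i then g j i else 1)) =
     (\<Prod>j\<in>{1..N} - {i}. if i < j then g i j else g j i)"
    by (rule prod.cong) auto
  finally show ?thesis .
qed

lemma config_weight_eq:
  "config_weight N \<theta> w l =
     (\<Prod>i\<in>{1..N}. \<Prod>j\<in>{i<..N}. pair_factor \<theta> (l j - l i)) * (\<Prod>i\<in>{1..N}. w (l i))"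
  by (simp add: config_weight_def pair_factor_def)

lemma config_weight_pos:
  assumes "\<theta> > 0" "\<And>x. w x > 0" "l \<in> configs N \<theta>"
  shows "0 < config_weight N \<theta> w l"
  unfolding config_weight_eq
  by (intro mult_pos_pos prod_pos ballI pair_factor_pos configs_gap[OF assms(1,3)] assms) auto

text \<open>
  The weights of two configurations that differ by one step of one particle are compared. Pairs
  without that particle contribute equally, every other pair is an instance of
  \<open>pair_factor_step\<close>, applied at the smaller of the two distances: the distance before the step
  for a particle on the right, and the distance after the step for a particle on the left.
\<close>

lemma config_weight_lower:
  assumes \<theta>: "\<theta> > 0" and l: "l \<in> configs N \<theta>" and i: "i \<in> {1..N}" and l': "l(i := l i - 1) \<in> configs N \<theta>"
  shows "config_weight N \<theta> w l * (\<Prod>j\<in>{1..N} - {i}. 1 - \<theta> / (l i - l j)) * w (l i - 1) =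
         config_weight N \<theta> w (l(i := l i - 1)) * (\<Prod>j\<in>{1..N} - {i}. 1 + \<theta> / (l i - 1 - l j)) * w (l i)"
proof -
  define k where "k = l(i := l i - 1)"
  define g where "g l a b = pair_factor \<theta> (l b - l a)" for l :: "nat \<Rightarrow> real" and a b :: nat
  define V where "V l = (\<Prod>a\<in>{1..N} - {i}. \<Prod>b\<in>{a<..N} - {i}. g l a b)" for l :: "nat \<Rightarrow> real"
  define T where "T l j = (if i < j then g l i j else g l j i)" for l :: "nat \<Rightarrow> real" and j
  define W where "W = (\<Prod>j\<in>{1..N} - {i}. w (l j))"
  have cw: "config_weight N \<theta> w m =
      V m * (\<Prod>j\<in>{1..N} - {i}. T m j) * (w (m i) * (\<Prod>j\<in>{1..N} - {i}. w (m j)))" for m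
    using prod_pairs_remove[OF i, of "g m"] prod.remove[OF finite_atLeastAtMost i, of "\<lambda>j. w (m j)"]
    by (simp only: config_weight_eq V_def T_def g_def)
  have "(\<Prod>j\<in>{1..N} - {i}. w (k j)) = W"
    unfolding W_def by (rule prod.cong) (auto simp: k_def)
  then have cwk: "config_weight N \<theta> w k = V k * (\<Prod>j\<in>{1..N} - {i}. T k j) * (w (l i - 1) * W)"
    using cw[of k] by (simp only: k_def fun_upd_same)
  have cwl: "config_weight N \<theta> w l = V l * (\<Prod>j\<in>{1..N} - {i}. T l j) * (w (l i) * W)"
    unfolding W_def by (rule cw)
  have V: "V l = V k"
    unfolding V_def by (intro prod.cong) (auto simp: g_def k_def)
  have TP: "(\<Prod>j\<in>{1..N} - {i}. T l j) * (\<Prod>j\<in>{1..N} - {i}. 1 - \<theta> / (l i - l j)) =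
      (\<Prod>j\<in>{1..N} - {i}. T k j) * (\<Prod>j\<in>{1..N} - {i}. 1 + \<theta> / (l i - 1 - l j))"
    unfolding prod.distrib[symmetric]
  proof (rule prod.cong)
    fix j assume j: "j \<in> {1..N} - {i}"
    show "T l j * (1 - \<theta> / (l i - l j)) = T k j * (1 + \<theta> / (l i - 1 - l j))"
    proof (cases "i < j")
      case True
      define x where "x = l j - l i"
      have "\<theta> \<le> x" using configs_gap[OF \<theta> l i _ True] j by (auto simp: x_def)
      note pair_factor_step[OF \<theta> this]
      moreover have "T l j = pair_factor \<theta> x" "T k j = pair_factor \<theta> (x + 1)"
        using True by (auto simp: T_def g_def k_def x_def algebra_simps)
      moreover have "l i - l j = - x" "l i - 1 - l j = - (x + 1)"
        by (auto simp: x_def)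
      ultimately show ?thesis by (simp only: divide_minus_right) simp
    next
      case False
      with j have ji: "j < i" by auto
      define x where "x = l i - 1 - l j"
      have "\<theta> \<le> x" using configs_gap[OF \<theta> l' _ i ji] j ji by (auto simp: x_def)
      note pair_factor_step[OF \<theta> this]
      moreover have "T l j = pair_factor \<theta> (x + 1)" "T k j = pair_factor \<theta> x"
        using ji by (auto simp: T_def g_def k_def x_def algebra_simps)
      moreover have "l i - l j = x + 1" "l i - 1 - l j = x"
        by (auto simp: x_def)
      ultimately show ?thesis by simp
    qed
  qed simp
  have "config_weight N \<theta> w l * (\<Prod>j\<in>{1..N} - {i}. 1 - \<theta> / (l i - l j)) * w (l i - 1) =
      V l * ((\<Prod>j\<in>{1..N} - {i}. T l j) * (\<Prod>j\<in>{1..N} - {i}. 1 - \<theta> / (l i - l j))) *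
        (w (l i) * w (l i - 1) * W)"
    unfolding cwl by (simp only: mult_ac)
  also have "\<dots> = config_weight N \<theta> w k * (\<Prod>j\<in>{1..N} - {i}. 1 + \<theta> / (l i - 1 - l j)) * w (l i)"
    unfolding cwk V TP by (simp only: mult_ac)
  finally show ?thesis unfolding k_def .
qed

section \<open>The ensemble as a weighted sum\<close>

definition config_prob :: "nat \<Rightarrow> real \<Rightarrow> (real \<Rightarrow> real) \<Rightarrow> (nat \<Rightarrow> real) \<Rightarrow> real" where
  "config_prob N \<theta> w l = config_weight N \<theta> w l / partition_fun N \<theta> w"

lemma config_prob_nonneg:
  assumes "\<theta> > 0" "\<And>x. w x > 0" "l \<in> configs N \<theta>"
  shows "0 \<le> config_prob N \<theta> w l"
  unfolding config_prob_def partition_fun_def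
  by (intro divide_nonneg_nonneg infsum_nonneg less_imp_le[OF config_weight_pos] assms)

text \<open>
  If the total weight diverges, its \<open>infsum\<close> is \<open>0\<close> and all the quotients are \<open>0\<close>; so the normalised
  weights are summable in every case.
\<close>

lemma config_prob_summable: "config_prob N \<theta> w summable_on configs N \<theta>"
proof (cases "config_weight N \<theta> w summable_on configs N \<theta>")
  case True
  then have "(\<lambda>l. config_weight N \<theta> w l * inverse (partition_fun N \<theta> w)) summable_on configs N \<theta>"
    by (rule summable_on_cmult_left)
  then show ?thesis by (simp add: config_prob_def[abs_def] divide_inverse)
next
  case False
  then have "partition_fun N \<theta> w = 0"
    unfolding partition_fun_def by (rule infsum_not_exists)
  then show ?thesis by (simp add: config_prob_def[abs_def])
qed

lemma integral_ensemble:
  fixes f :: "(nat \<Rightarrow> real) \<Rightarrow> complex"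
  assumes "\<theta> > 0" "\<And>x. w x > 0" and bound: "\<And>l. l \<in> configs N \<theta> \<Longrightarrow> norm (f l) \<le> B"
  shows "(\<integral>l. f l \<partial>ensemble N \<theta> w) = (\<Sum>\<^sub>\<infinity>l\<in>configs N \<theta>. of_real (config_prob N \<theta> w l) * f l)"
proof -
  have "(\<integral>l. f l \<partial>ensemble N \<theta> w) =
      (\<integral>l. config_prob N \<theta> w l *\<^sub>R f l \<partial>count_space (configs N \<theta>))"
    unfolding ensemble_def point_measure_def config_prob_def[symmetric]
    by (rule integral_density) (use config_prob_nonneg[of \<theta> w _ N] assms in \<open>auto simp: AE_count_space\<close>)
  also have "\<dots> = infsetsum (\<lambda>l. of_real (config_prob N \<theta> w l) * f l) (configs N \<theta>)"
    by (simp add: infsetsum_def scaleR_conv_of_real)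
  also have "\<dots> = (\<Sum>\<^sub>\<infinity>l\<in>configs N \<theta>. of_real (config_prob N \<theta> w l) * f l)"
  proof (rule infsetsum_infsum)
    have "(\<lambda>l. norm (of_real (config_prob N \<theta> w l) * f l)) summable_on configs N \<theta>"
      by (rule weighted_summable(1)[OF config_prob_summable config_prob_nonneg bound])
         (use assms in auto)
    then show "Infinite_Set_Sum.abs_summable_on (\<lambda>l. of_real (config_prob N \<theta> w l) * f l) (configs N \<theta>)"
      by (simp add: abs_summable_equivalent[symmetric])
  qed
  finally show ?thesis .
qed

lemma weighted_tuples_configs:
  assumes "\<theta> > 0" "\<And>x. w x > 0" "s \<in> {0, 1}"
  shows "weighted_tuples (configs N \<theta>) (config_prob N \<theta> w) {1..N}
           (\<lambda>l i. of_real (l i + s)) (nekrasov_sing N \<theta>)"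
proof
  fix l assume l: "l \<in> configs N \<theta>"
  show "0 \<le> config_prob N \<theta> w l"
    by (rule config_prob_nonneg) (use assms l in auto)
  have "inj_on l {1..N}" using l by (auto simp: configs_def strict_mono_on_imp_inj_on)
  then show "inj_on (\<lambda>i. complex_of_real (l i + s)) {1..N}"
    unfolding inj_on_def of_real_eq_iff add_right_cancel .
  show "complex_of_real (l i + s) \<in> nekrasov_sing N \<theta>" if "i \<in> {1..N}" for i
  proof -
    have "complex_of_real (l i + s) \<in> {of_real (l i), of_real (l i) + 1}"
      using assms(3) by auto
    then show ?thesis using l that unfolding nekrasov_sing_def by blast
  qed
qed (simp_all add: config_prob_summable nekrasov_sing_no_limpt)

abbreviation shifted_mean :: "nat \<Rightarrow> real \<Rightarrow> (real \<Rightarrow> real) \<Rightarrow> real \<Rightarrow> complex \<Rightarrow> complex \<Rightarrow> complex" where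
  "shifted_mean N \<theta> w s \<equiv>
     weighted_tuples.mean (configs N \<theta>) (config_prob N \<theta> w) {1..N} (\<lambda>l i. of_real (l i + s))"

abbreviation shifted_mean_residue :: "nat \<Rightarrow> real \<Rightarrow> (real \<Rightarrow> real) \<Rightarrow> real \<Rightarrow> complex \<Rightarrow> complex \<Rightarrow> complex" where
  "shifted_mean_residue N \<theta> w s \<equiv>
     weighted_tuples.mean_residue (configs N \<theta>) (config_prob N \<theta> w) {1..N} (\<lambda>l i. of_real (l i + s))"

lemma shifted_mean_eq_integral:
  assumes \<theta>: "\<theta> > 0" and w: "\<And>x. w x > 0" and s: "s \<in> {0, 1}" and \<xi>: "\<xi> \<notin> nekrasov_sing N \<theta>"
  shows "(\<integral>l. (\<Prod>i\<in>{1..N}. 1 + \<kappa> / (\<xi> - of_real (l i + s))) \<partial>ensemble N \<theta> w) = shifted_mean N \<theta> w s \<kappa> \<xi>"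
proof -
  interpret weighted_tuples "configs N \<theta>" "config_prob N \<theta> w" "{1..N}"
    "\<lambda>l i. of_real (l i + s)" "nekrasov_sing N \<theta>"
    by (rule weighted_tuples_configs[OF \<theta> w s])
  obtain r where r: "r > 0" "\<And>y. y \<in> nekrasov_sing N \<theta> \<Longrightarrow> y \<noteq> \<xi> \<Longrightarrow> 2 * r \<le> dist y \<xi>"
    by (rule separation[of \<xi>]) blast
  have far: "r \<le> norm (\<xi> - of_real (l i + s))" if "l \<in> configs N \<theta>" "i \<in> {1..N}" for l i
  proof -
    have "of_real (l i + s) \<noteq> \<xi>" using a_in_S[OF that] \<xi> by metis
    then show ?thesis using r(1) r(2)[OF a_in_S[OF that]] by (simp add: dist_norm norm_minus_commute)
  qed
  show ?thesis
    unfolding mean_def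
    by (rule integral_ensemble[OF \<theta> w]) (rule norm_prod_one_plus_quotient_le[OF r(1) far])
qed

lemma nekrasov_R_eq_means:
  assumes "\<theta> > 0" "\<And>x. w x > 0" "\<xi> \<notin> nekrasov_sing N \<theta>"
  shows "nekrasov_R N \<theta> w \<phi>p \<phi>m \<xi> =
     \<phi>m \<xi> * shifted_mean N \<theta> w 0 (- of_real \<theta>) \<xi> + \<phi>p \<xi> * shifted_mean N \<theta> w 1 (of_real \<theta>) \<xi>"
  using shifted_mean_eq_integral[where w = w and s = 0 and \<kappa> = "- of_real \<theta>", OF assms(1,2) _ assms(3)]
        shifted_mean_eq_integral[where w = w and s = 1 and \<kappa> = "of_real \<theta>", OF assms(1,2) _ assms(3)]
  by (simp add: nekrasov_R_def diff_diff_eq)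

section \<open>Cancellation of the residues\<close>

text \<open>
  The ratio of the one-particle weights, given by \<open>rel\<close>, compensates the part of the change of the
  weight that the interaction leaves. The relation is kept free of denominators, so that \<open>c\<close> and
  \<open>d\<close> may be the values of \<open>\<phi>m\<close> and \<open>\<phi>p\<close> at a common zero.
\<close>

lemma residue_term_shift:
  assumes \<theta>: "\<theta> > 0" and w: "\<And>x. w x > 0" and i: "i \<in> {1..N}"
    and l: "l \<in> configs N \<theta>" and l': "l(i := x - 1) \<in> configs N \<theta>" and x: "l i = x"
    and rel: "c * of_real (w x) = d * of_real (w (x - 1))"
  shows "c * (of_real (config_prob N \<theta> w l) *
             (\<Prod>j\<in>{1..N} - {i}. 1 + - of_real \<theta> / (of_real x - of_real (l j)))) =
         d * (of_real (config_prob N \<theta> w (l(i := x - 1))) *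
             (\<Prod>j\<in>{1..N} - {i}. 1 + of_real \<theta> / (of_real x - of_real ((l(i := x - 1)) j + 1)) :: complex))"
proof -
  define P where "P = (\<Prod>j\<in>{1..N} - {i}. 1 - \<theta> / (x - l j))"
  define Q where "Q = (\<Prod>j\<in>{1..N} - {i}. 1 + \<theta> / (x - 1 - l j))"
  have P: "(\<Prod>j\<in>{1..N} - {i}. 1 + - of_real \<theta> / (of_real x - of_real (l j))) = complex_of_real P"
    by (simp add: P_def)
  have Q: "(\<Prod>j\<in>{1..N} - {i}. 1 + of_real \<theta> / (of_real x - of_real ((l(i := x - 1)) j + 1))) = complex_of_real Q"
    unfolding Q_def of_real_prod by (rule prod.cong) (auto simp: algebra_simps)
  have "config_prob N \<theta> w l * P * w (x - 1) = config_prob N \<theta> w (l(i := x - 1)) * Q * w x"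
    using config_weight_lower[OF \<theta> l i, of w] l' x by (simp add: config_prob_def P_def Q_def)
  then have "complex_of_real (config_prob N \<theta> w l * P * w (x - 1)) =
      of_real (config_prob N \<theta> w (l(i := x - 1)) * Q * w x)" by simp
  then have "c * (of_real (config_prob N \<theta> w l) * of_real P) * of_real (w (x - 1)) =
      (c * of_real (w x)) * (of_real (config_prob N \<theta> w (l(i := x - 1))) * of_real Q)"
    by (simp add: mult_ac)
  then have "c * (of_real (config_prob N \<theta> w l) * of_real P) * of_real (w (x - 1)) =
      d * (of_real (config_prob N \<theta> w (l(i := x - 1))) * of_real Q) * of_real (w (x - 1))"
    unfolding rel by (simp only: mult_ac)
  moreover have "complex_of_real (w (x - 1)) \<noteq> 0" using w[of "x - 1"] by simp
  ultimately show ?thesis unfolding P Q by simp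
qed

text \<open>
  For each particle \<open>i\<close>, the pole at \<open>x\<close> of the first mean comes from the configurations with
  \<open>l i = x\<close>, that of the second mean from those with \<open>l i = x - 1\<close>. The step \<open>l i \<mapsto> l i - 1\<close> is a
  bijection between those configurations of either kind for which it, or its inverse, is possible,
  and the corresponding terms cancel by \<open>residue_term_shift\<close>. At the remaining configurations the
  residue is zero since a neighbouring particle at distance \<open>\<theta>\<close> makes one factor vanish.
\<close>

lemma residues_cancel:
  assumes \<theta>: "\<theta> > 0" and w: "\<And>x. w x > 0"
    and rel: "c * of_real (w x) = d * of_real (w (x - 1))"
  shows "c * shifted_mean_residue N \<theta> w 0 (- of_real \<theta>) (of_real x) +
         d * shifted_mean_residue N \<theta> w 1 (of_real \<theta>) (of_real x) = 0"
proof -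
  define f where "f i l = of_real (config_prob N \<theta> w l) *
      (- of_real \<theta> * (\<Prod>j\<in>{1..N} - {i}. 1 + - of_real \<theta> / (of_real x - complex_of_real (l j + 0))))" for i l
  define g where "g i l = of_real (config_prob N \<theta> w l) *
      (of_real \<theta> * (\<Prod>j\<in>{1..N} - {i}. 1 + of_real \<theta> / (of_real x - complex_of_real (l j + 1))))" for i l
  have "c * (\<Sum>\<^sub>\<infinity>l | l \<in> configs N \<theta> \<and> complex_of_real (l i + 0) = of_real x. f i l) =
        - (d * (\<Sum>\<^sub>\<infinity>l | l \<in> configs N \<theta> \<and> complex_of_real (l i + 1) = of_real x. g i l))"
    if i: "i \<in> {1..N}" for i
  proof -
    define A where "A = {l \<in> configs N \<theta>. l i = x \<and> l(i := x - 1) \<in> configs N \<theta>}"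
    define B where "B = {l \<in> configs N \<theta>. l i = x - 1 \<and> l(i := x) \<in> configs N \<theta>}"
    have f0: "f i l = 0"
      if l: "l \<in> configs N \<theta>" "l i = x" "l(i := x - 1) \<notin> configs N \<theta>" for l
    proof -
      obtain j where "j \<in> {1..N} - {i}" "x - l j = \<theta>"
        using configs_lower_blocked[OF \<theta> l(1) i] l(2,3) by blast
      moreover from this have "of_real x - complex_of_real (l j + 0) = of_real \<theta>"
        by (metis add.right_neutral of_real_diff)
      ultimately have "\<exists>j\<in>{1..N} - {i}. 1 + - of_real \<theta> / (of_real x - complex_of_real (l j + 0)) = 0"
        using \<theta> by (intro bexI[of _ j]) auto
      then show ?thesis unfolding f_def by (simp only: prod_zero finite_Diff finite_atLeastAtMost mult_zero_right)
    qed
    have g0: "g i l = 0"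
      if l: "l \<in> configs N \<theta>" "l i = x - 1" "l(i := x) \<notin> configs N \<theta>" for l
    proof -
      have "l(i := l i + 1) \<notin> configs N \<theta>" using l(2,3) by simp
      then obtain j where "j \<in> {1..N} - {i}" "l j - l i = \<theta>"
        using configs_raise_blocked[OF \<theta> l(1) i] by blast
      moreover from this have "x - (l j + 1) = - \<theta>" using l(2) by simp
      then have "of_real x - complex_of_real (l j + 1) = - of_real \<theta>"
        by (metis of_real_diff of_real_minus)
      then have "1 + of_real \<theta> / (of_real x - complex_of_real (l j + 1)) = 0"
        using \<theta> by (simp only:) simp
      ultimately have "\<exists>j\<in>{1..N} - {i}. 1 + of_real \<theta> / (of_real x - complex_of_real (l j + 1)) = 0"
        by blast
      then show ?thesis unfolding g_def by (simp only: prod_zero finite_Diff finite_atLeastAtMost mult_zero_right)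
    qed
    have "bij_betw (\<lambda>l. l(i := x - 1)) A B"
    proof (rule bij_betw_byWitness[of _ "\<lambda>l. l(i := x)"])
      show A: "\<forall>l\<in>A. (l(i := x - 1))(i := x) = l"
        by (simp add: A_def fun_upd_idem)
      show B: "\<forall>l\<in>B. (l(i := x))(i := x - 1) = l"
        by (simp add: B_def fun_upd_idem)
      show "(\<lambda>l. l(i := x - 1)) ` A \<subseteq> B"
        using A by (fastforce simp add: A_def B_def simp del: fun_upd_upd)
      show "(\<lambda>l. l(i := x)) ` B \<subseteq> A"
        using B by (fastforce simp add: A_def B_def simp del: fun_upd_upd)
    qed
    note AB = infsum_reindex_bij_betw[OF this, of "g i"]
    have "c * (\<Sum>\<^sub>\<infinity>l | l \<in> configs N \<theta> \<and> complex_of_real (l i + 0) = of_real x. f i l) = c * infsum (f i) A"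
      by (intro arg_cong[of _ _ "\<lambda>s. c * s"] infsum_cong_neutral) (auto simp: A_def f0)
    also have "\<dots> = (\<Sum>\<^sub>\<infinity>l\<in>A. c * f i l)"
      by (simp add: infsum_cmult_right')
    also have "\<dots> = (\<Sum>\<^sub>\<infinity>l\<in>A. - d * g i (l(i := x - 1)))"
    proof (rule infsum_cong)
      fix l assume "l \<in> A"
      then have l: "l \<in> configs N \<theta>" "l(i := x - 1) \<in> configs N \<theta>" "l i = x"
        by (auto simp: A_def)
      show "c * f i l = - d * g i (l(i := x - 1))"
        using arg_cong[OF residue_term_shift[where w = w, OF \<theta> w i l rel], of "\<lambda>s. - of_real \<theta> * s"]
        by (simp add: f_def g_def mult_ac del: fun_upd_apply)
    qed
    also have "\<dots> = - (d * (\<Sum>\<^sub>\<infinity>l\<in>A. g i (l(i := x - 1))))"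
      unfolding infsum_cmult_right' by simp
    also note AB
    also have "infsum (g i) B = (\<Sum>\<^sub>\<infinity>l | l \<in> configs N \<theta> \<and> complex_of_real (l i + 1) = of_real x. g i l)"
    proof (rule infsum_cong_neutral)
      have "l i = x - 1" if "complex_of_real (l i + 1) = of_real x" for l
        using that by (simp only: of_real_eq_iff eq_diff_eq)
      then show "g i l = 0" if "l \<in> {l. l \<in> configs N \<theta> \<and> complex_of_real (l i + 1) = of_real x} - B" for l
        using that g0 by (auto simp: B_def)
    qed (auto simp: B_def)
    finally show ?thesis .
  qed
  then have "c * (\<Sum>i\<in>{1..N}. \<Sum>\<^sub>\<infinity>l | l \<in> configs N \<theta> \<and> complex_of_real (l i + 0) = of_real x. f i l) =
      - (d * (\<Sum>i\<in>{1..N}. \<Sum>\<^sub>\<infinity>l | l \<in> configs N \<theta> \<and> complex_of_real (l i + 1) = of_real x. g i l))"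
    unfolding sum_distrib_left sum_negf[symmetric] by (rule sum.cong[OF refl])
  then show ?thesis
    unfolding f_def g_def
      weighted_tuples.mean_residue_def[OF weighted_tuples_configs[where w = w, OF \<theta> w insertI1]]
      weighted_tuples.mean_residue_def[OF weighted_tuples_configs[where w = w, OF \<theta> w insertI2[OF singletonI]]]
    by (simp only: left_minus)
qed

section \<open>Holomorphy and degree of the Nekrasov function\<close>

lemma nekrasov_R_extends:
  assumes \<theta>: "\<theta> > 0" and w: "\<And>x. w x > 0" and M: "open M"
    and hol: "\<phi>p holomorphic_on M" "\<phi>m holomorphic_on M"
    and rel: "\<And>x. of_real x \<in> M \<Longrightarrow>
      \<phi>m (of_real x) * of_real (w x) = \<phi>p (of_real x) * of_real (w (x - 1))"
  shows "\<exists>F. F holomorphic_on M \<and> (\<forall>\<xi>\<in>M - nekrasov_sing N \<theta>. F \<xi> = nekrasov_R N \<theta> w \<phi>p \<phi>m \<xi>)"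
proof -
  interpret m0: weighted_tuples "configs N \<theta>" "config_prob N \<theta> w" "{1..N}"
    "\<lambda>l i. of_real (l i + 0)" "nekrasov_sing N \<theta>"
    by (rule weighted_tuples_configs[OF \<theta> w]) auto
  interpret m1: weighted_tuples "configs N \<theta>" "config_prob N \<theta> w" "{1..N}"
    "\<lambda>l i. of_real (l i + 1)" "nekrasov_sing N \<theta>"
    by (rule weighted_tuples_configs[OF \<theta> w]) auto
  let ?R = "\<lambda>\<xi>. \<phi>m \<xi> * m0.mean (- of_real \<theta>) \<xi> + \<phi>p \<xi> * m1.mean (of_real \<theta>) \<xi>"
  have "\<exists>F. F holomorphic_on M \<and> (\<forall>\<xi>\<in>M - nekrasov_sing N \<theta>. F \<xi> = ?R \<xi>)"
  proof (rule holomorphic_extension_across_discrete[OF M nekrasov_sing_no_limpt])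
    show "?R holomorphic_on M - nekrasov_sing N \<theta>"
      by (intro holomorphic_intros holomorphic_on_subset[OF hol(1)] holomorphic_on_subset[OF hol(2)]
            holomorphic_on_subset[OF m0.mean_holomorphic] holomorphic_on_subset[OF m1.mean_holomorphic]) auto
    fix z assume z: "z \<in> M \<inter> nekrasov_sing N \<theta>"
    then have "Im z = 0" by (auto simp: nekrasov_sing_def)
    then obtain x where x: "z = of_real x" by (metis complex_is_Real_iff Reals_cases)
    have cont: "(\<phi>p \<longlongrightarrow> \<phi>p z) (at z)" "(\<phi>m \<longlongrightarrow> \<phi>m z) (at z)"
      using hol[THEN holomorphic_on_imp_continuous_on] z M
      by (simp_all add: continuous_on_eq_continuous_at isCont_def)
    have "((\<lambda>y. \<phi>m y * ((y - z) * m0.mean (- of_real \<theta>) y) + \<phi>p y * ((y - z) * m1.mean (of_real \<theta>) y)) \<longlongrightarrow>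
        \<phi>m z * m0.mean_residue (- of_real \<theta>) z + \<phi>p z * m1.mean_residue (of_real \<theta>) z) (at z)"
      by (intro tendsto_intros cont m0.mean_simple_pole m1.mean_simple_pole)
    moreover have "\<phi>m z * m0.mean_residue (- of_real \<theta>) z + \<phi>p z * m1.mean_residue (of_real \<theta>) z = 0"
      unfolding x by (rule residues_cancel[where w = w, OF \<theta> w rel]) (use x z in auto)
    ultimately show "((\<lambda>y. (y - z) * ?R y) \<longlongrightarrow> 0) (at z)"
      by (simp add: algebra_simps)
  qed
  then show ?thesis
    using nekrasov_R_eq_means[where w = w, OF \<theta> w] by auto
qed

text \<open>
  At a fixed distance from all the poles the means are bounded, since the weights have a finite
  sum; the growth is then that of the two polynomials.
\<close>

lemma nekrasov_R_bound_on_circles: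
  assumes \<theta>: "\<theta> > 0" and w: "\<And>x. w x > 0" and "degree p \<le> d" "degree q \<le> d"
  shows "\<exists>\<rho> K. 0 < \<rho> \<and> \<rho> < 1 \<and> (\<forall>n z. norm z = real n + \<rho> \<longrightarrow> 1 \<le> norm z \<longrightarrow>
     z \<notin> nekrasov_sing N \<theta> \<and> norm (nekrasov_R N \<theta> w (poly p) (poly q) z) \<le> K * norm z ^ d)"
proof -
  interpret m0: weighted_tuples "configs N \<theta>" "config_prob N \<theta> w" "{1..N}"
    "\<lambda>l i. of_real (l i + 0)" "nekrasov_sing N \<theta>"
    by (rule weighted_tuples_configs[OF \<theta> w]) auto
  interpret m1: weighted_tuples "configs N \<theta>" "config_prob N \<theta> w" "{1..N}"
    "\<lambda>l i. of_real (l i + 1)" "nekrasov_sing N \<theta>"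
    by (rule weighted_tuples_configs[OF \<theta> w]) auto
  obtain \<rho> \<delta> :: real where \<rho>: "0 < \<rho>" "\<rho> < 1" and \<delta>: "0 < \<delta>"
    and far': "\<And>(n::nat) (z::complex) y. norm z = real n + \<rho> \<Longrightarrow>
      y \<in> of_real ` int_translates ((\<lambda>i. \<theta> * real i) ` {1..N}) \<Longrightarrow> \<delta> \<le> dist z y"
    using circles_avoiding_int_translates[of "(\<lambda>i. \<theta> * real i) ` {1..N}"] by blast
  have far: "\<delta> \<le> dist z y" if "norm z = real n + \<rho>" "y \<in> nekrasov_sing N \<theta>" for n z y
    using far'[OF that(1)] that(2) nekrasov_sing_subset by blast
  define C where "C = (\<Sum>\<^sub>\<infinity>l\<in>configs N \<theta>. config_prob N \<theta> w l) * (1 + \<theta> / \<delta>) ^ card {1..N}"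
  define cp where "cp = (\<Sum>i\<le>d. norm (coeff p i))"
  define cq where "cq = (\<Sum>i\<le>d. norm (coeff q i))"
  show ?thesis
  proof (rule exI[of _ \<rho>], rule exI[of _ "(cq + cp) * C"], intro conjI allI impI \<rho>)
    fix n :: nat and z :: complex
    assume z: "norm z = real n + \<rho>" "1 \<le> norm z"
    show z_notin: "z \<notin> nekrasov_sing N \<theta>"
      using far[OF z(1), of z] \<delta> by auto
    have m0: "norm (m0.mean (- of_real \<theta>) z) \<le> C"
      using m0.norm_mean_le[OF \<delta> far[OF z(1)], of "- of_real \<theta>"] \<theta> by (simp add: C_def)
    have m1: "norm (m1.mean (of_real \<theta>) z) \<le> C"
      using m1.norm_mean_le[OF \<delta> far[OF z(1)], of "of_real \<theta>"] \<theta> by (simp add: C_def)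
    have le: "norm (poly p z) \<le> cp * norm z ^ d" "norm (poly q z) \<le> cq * norm z ^ d"
      unfolding cp_def cq_def using assms(3,4) z(2) by (simp_all add: norm_poly_le)
    have "norm (nekrasov_R N \<theta> w (poly p) (poly q) z) \<le>
        norm (poly q z) * norm (m0.mean (- of_real \<theta>) z) + norm (poly p z) * norm (m1.mean (of_real \<theta>) z)"
      unfolding nekrasov_R_eq_means[where w = w, OF \<theta> w z_notin] norm_mult[symmetric] by (rule norm_triangle_ineq)
    also have "\<dots> \<le> (cq * norm z ^ d) * C + (cp * norm z ^ d) * C"
      by (intro add_mono mult_mono le m0 m1 norm_ge_zero le[THEN order_trans[OF norm_ge_zero]])
    finally show "norm (nekrasov_R N \<theta> w (poly p) (poly q) z) \<le> (cq + cp) * C * norm z ^ d"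
      by (simp add: algebra_simps)
  qed
qed

theorem theorem1p1:
  fixes N :: nat and \<theta> :: real and w :: "real \<Rightarrow> real"
    and \<phi>p \<phi>m :: "complex \<Rightarrow> complex" and D :: "complex set"
  assumes "N \<ge> 1" and "\<theta> > 0"
    and w_pos: "\<And>x. w x > 0"
    and w_decay: "\<exists>c>0. w \<in> O[at_infinity](\<lambda>x. \<bar>x\<bar> powr (- (2 * real N - 2) * \<theta> - 1 - c))"
    (* D is the set on which the functions \<phi>p, \<phi>m are defined.  The ratio of weights is finite, so
       a zero of \<phi>m has to be a zero of \<phi>p; nothing else is required at a common zero. *)
    and ratio: "\<And>x::real. of_real x \<in> D \<Longrightarrow> \<phi>m (of_real x) \<noteq> 0 \<Longrightarrow>
                  of_real (w x / w (x - 1)) = \<phi>p (of_real x) / \<phi>m (of_real x)"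
    and ratio_zero: "\<And>x::real. of_real x \<in> D \<Longrightarrow> \<phi>m (of_real x) = 0 \<Longrightarrow> \<phi>p (of_real x) = 0"
  shows "(\<forall>M. open M \<and> connected M \<and> M \<subseteq> D \<and> \<phi>p holomorphic_on M \<and> \<phi>m holomorphic_on M \<longrightarrow>
            (\<exists>F. F holomorphic_on M \<and>
                 (\<forall>\<xi>\<in>M - nekrasov_sing N \<theta>. F \<xi> = nekrasov_R N \<theta> w \<phi>p \<phi>m \<xi>))) \<and>
         (\<forall>d::nat. D = UNIV \<and>
            (\<exists>p q :: complex poly. degree p \<le> d \<and> degree q \<le> d \<and> \<phi>p = poly p \<and> \<phi>m = poly q) \<longrightarrow>
            (\<exists>r :: complex poly. degree r \<le> d \<and>
                 (\<forall>\<xi>. \<xi> \<notin> nekrasov_sing N \<theta> \<longrightarrow> nekrasov_R N \<theta> w \<phi>p \<phi>m \<xi> = poly r \<xi>)))"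
proof -
  have rel: "\<phi>m (of_real x) * of_real (w x) = \<phi>p (of_real x) * of_real (w (x - 1))"
    if "of_real x \<in> D" for x
  proof (cases "\<phi>m (of_real x) = 0")
    case True
    then show ?thesis using ratio_zero[OF that] by simp
  next
    case False
    have "complex_of_real (w (x - 1)) \<noteq> 0" using w_pos[of "x - 1"] by simp
    then show ?thesis using ratio[OF that False] False by (simp add: field_simps)
  qed
  have ext: "\<exists>F. F holomorphic_on M \<and>
      (\<forall>\<xi>\<in>M - nekrasov_sing N \<theta>. F \<xi> = nekrasov_R N \<theta> w \<phi>p \<phi>m \<xi>)"
    if "open M" "M \<subseteq> D" "\<phi>p holomorphic_on M" "\<phi>m holomorphic_on M" for M
    by (rule nekrasov_R_extends[where w = w, OF \<open>\<theta> > 0\<close> w_pos that(1,3,4) rel]) (use that(2) in auto)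
  have "\<exists>r. degree r \<le> d \<and> (\<forall>\<xi>. \<xi> \<notin> nekrasov_sing N \<theta> \<longrightarrow> nekrasov_R N \<theta> w \<phi>p \<phi>m \<xi> = poly r \<xi>)"
    if D: "D = UNIV" and pq: "degree p \<le> d" "degree q \<le> d" "\<phi>p = poly p" "\<phi>m = poly q" for d p q
  proof -
    have "poly p holomorphic_on UNIV" "poly q holomorphic_on UNIV"
      by (intro holomorphic_intros)+
    then obtain F where F: "F holomorphic_on UNIV"
        "\<And>\<xi>. \<xi> \<notin> nekrasov_sing N \<theta> \<Longrightarrow> F \<xi> = nekrasov_R N \<theta> w \<phi>p \<phi>m \<xi>"
      using ext[of UNIV] D pq by auto
    obtain \<rho> K where \<rho>: "0 < \<rho>" "\<rho> < 1"
      and bound: "\<And>n z. norm z = real n + \<rho> \<Longrightarrow> 1 \<le> norm z \<Longrightarrow>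
        z \<notin> nekrasov_sing N \<theta> \<and> norm (nekrasov_R N \<theta> w (poly p) (poly q) z) \<le> K * norm z ^ d"
      using nekrasov_R_bound_on_circles[where w = w and N = N, OF \<open>\<theta> > 0\<close> w_pos pq(1,2)] by blast
    have "\<exists>r. degree r \<le> d \<and> (\<forall>z. F z = poly r z)"
    proof (rule polynomial_of_growth_on_circles[OF F(1) \<rho>])
      fix n :: nat and z :: complex
      assume "norm z = real n + \<rho>" "1 \<le> norm z"
      from bound[OF this] show "norm (F z) \<le> K * norm z ^ d"
        by (simp add: F(2) pq)
    qed
    then obtain r where "degree r \<le> d" "\<And>z. F z = poly r z" by blast
    then show ?thesis using F(2) by (intro exI[of _ r]) auto
  qed
  with ext show ?thesis by blast
qed

end
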